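(* Let $a<b$ be real numbers and let $p:[a,b]\to[1,+\infty)$ be Lebesgue integrable and bounded. Then $BV^{p(\cdot)}[a,b]\subset WBV_{p(\cdot)}[a,b]$.
   Context: For a nondegenerate closed interval $Q=[s,t]\subset[a,b]$ put $f(Q):=f(t)-f(s)$, $|Q|=t-s$, and $\bar p(Q):=\left(\frac{1}{|Q|}\int_Q\frac{1}{p(x)}\,dx\right)^{-1}$. A finite partition of $[a,b]$ is a family $P=\{Q_k\}_{k=1}^n$ with $Q_k=[t_{k-1},t_k]$ and $a=t_0<\dots<t_n=b$; $\Pi[a,b]$ is the set of all finite partitions. Define $$V_a^b(p,f):=\sup_{P\in\Pi[a,b]}\sum_{k=1}^n|f(Q_k)|^{\bar p(Q_k)}\in[0,+\infty],$$ $$\|f\|_{WBV_{p(\cdot)}}:=\inf\{\lambda>0: V_a^b(p,f/\lambda)\le 1\}\quad(\inf\emptyset=+\infty),$$ $$WBV_{p(\cdot)}[a,b]:=\{f:[a,b]\to\mathbb{R}: f(a)=0,\ \|f\|_{WBV_{p(\cdot)}}<+\infty\}.$$ A tagged partition of $[a,b]$ is a finite partition $\{Q_k\}_{k=1}^n$ together with points $x_k\in[t_{k-1},t_k]$, $k=1,\dots,n$; $\Pi^*[a,b]$ is the set of all tagged partitions. For bounded $p$ define $$V^{p(\cdot)}_{[a,b]}(f):=\sup_{\Pi^*[a,b]}\sum_{k=1}^n|f(Q_k)|^{p(x_k)},\qquad \|f\|_{BV^{p(\cdot)}}:=\inf\{\lambda>0: V^{p(\cdot)}_{[a,b]}(f/\lambda)\le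 1\},$$ $$BV^{p(\cdot)}[a,b]:=\{f:[a,b]\to\mathbb{R}: f(a)=0,\ \|f\|_{BV^{p(\cdot)}}<+\infty\}.$$ *)

theory Defs
  imports "HOL-Analysis.Analysis"
begin

text \<open>
  The pair \<open>(n, t)\<close> encodes the partition \<open>a = t 0 < \<dots> < t n = b\<close>; the values of \<open>t\<close> beyond
  \<open>n\<close> are irrelevant. The intervals \<open>Q\<^sub>k = [t\<^sub>k\<^sub>-\<^sub>1, t\<^sub>k]\<close>, \<open>1 \<le> k \<le> n\<close>, are indexed from \<open>0\<close>, as
  \<open>{t k..t (Suc k)}\<close> with \<open>k < n\<close>.
\<close>
definition partitions :: "real \<Rightarrow> real \<Rightarrow> (nat \<times> (nat \<Rightarrow> real)) set" where
  "partitions a b = {(n, t). t 0 = a \<and> t n = b \<and> (\<forall>k<n. t k < t (Suc k))}"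

definition tagged_partitions ::
    "real \<Rightarrow> real \<Rightarrow> (nat \<times> (nat \<Rightarrow> real) \<times> (nat \<Rightarrow> real)) set" where
  "tagged_partitions a b =
     {(n, t, x). (n, t) \<in> partitions a b \<and> (\<forall>k<n. x k \<in> {t k..t (Suc k)})}"

definition pbar :: "(real \<Rightarrow> real) \<Rightarrow> real \<Rightarrow> real \<Rightarrow> real" where
  "pbar p s t = inverse ((1 / (t - s)) * (LINT x:{s..t}|lebesgue. 1 / p x))"

definition WBV_var :: "real \<Rightarrow> real \<Rightarrow> (real \<Rightarrow> real) \<Rightarrow> (real \<Rightarrow> real) \<Rightarrow> ennreal" where
  "WBV_var a b p f =
     (SUP (n, t) \<in> partitions a b.
        ennreal (\<Sum>k<n. \<bar>f (t (Suc k)) - f (t k)\<bar> powr pbar p (t k) (t (Suc k))))"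

definition WBV_norm :: "real \<Rightarrow> real \<Rightarrow> (real \<Rightarrow> real) \<Rightarrow> (real \<Rightarrow> real) \<Rightarrow> ennreal" where
  "WBV_norm a b p f = Inf {ennreal l |l. l > 0 \<and> WBV_var a b p (\<lambda>x. f x / l) \<le> 1}"

text \<open>Functions \<open>[a,b] \<rightarrow> \<real>\<close> are represented by total functions that are \<open>undefined\<close> off \<open>[a,b]\<close>.\<close>
definition WBV :: "real \<Rightarrow> real \<Rightarrow> (real \<Rightarrow> real) \<Rightarrow> (real \<Rightarrow> real) set" where
  "WBV a b p = {f \<in> {a..b} \<rightarrow>\<^sub>E UNIV. f a = 0 \<and> WBV_norm a b p f < \<infinity>}"

definition BV_var :: "real \<Rightarrow> real \<Rightarrow> (real \<Rightarrow> real) \<Rightarrow> (real \<Rightarrow> real) \<Rightarrow> ennreal" where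
  "BV_var a b p f =
     (SUP (n, t, x) \<in> tagged_partitions a b.
        ennreal (\<Sum>k<n. \<bar>f (t (Suc k)) - f (t k)\<bar> powr p (x k)))"

definition BV_norm :: "real \<Rightarrow> real \<Rightarrow> (real \<Rightarrow> real) \<Rightarrow> (real \<Rightarrow> real) \<Rightarrow> ennreal" where
  "BV_norm a b p f = Inf {ennreal l |l. l > 0 \<and> BV_var a b p (\<lambda>x. f x / l) \<le> 1}"

definition BV :: "real \<Rightarrow> real \<Rightarrow> (real \<Rightarrow> real) \<Rightarrow> (real \<Rightarrow> real) set" where
  "BV a b p = {f \<in> {a..b} \<rightarrow>\<^sub>E UNIV. f a = 0 \<and> BV_norm a b p f < \<infinity>}"

end

theory Submission
  imports Defs
begin

text \<open>
  The inclusion holds with the same scaling constant on both sides: if \<open>BV_var a b p g \<le> 1\<close> for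
  \<open>g = f / l\<close>, then also \<open>WBV_var a b p g \<le> 1\<close>. Since \<open>pbar p s t\<close> is the harmonic mean of \<open>p\<close> over
  \<open>{s..t}\<close>, some point \<open>x\<close> of that interval satisfies \<open>p x \<le> pbar p s t\<close>
  (\<open>exists_le_pbar\<close>, a consequence of the mean value inequality \<open>exists_ge_mean\<close> for \<open>1 / p\<close>).
  Tag each interval of a partition with such a point. Every term \<open>\<bar>g(Q)\<bar> powr p x\<close> of the
  resulting tagged sum is at most \<open>1\<close>, so \<open>\<bar>g(Q)\<bar> \<le> 1\<close>, and for such increments raising the exponent
  from \<open>p x\<close> to \<open>pbar\<close> only decreases the power. The untagged sum is thus bounded by a tagged one
  (\<open>WBV_var_le_1_if_BV_var_le_1\<close>).
\<close>

text \<open>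
  If \<open>h\<close> were strictly below its mean at every point, integrating over the interval, which has
  positive measure, would put the integral of \<open>h\<close> strictly below itself.
\<close>
lemma exists_ge_mean:
  fixes h :: "real \<Rightarrow> real"
  assumes "s < t" and h: "set_integrable lebesgue {s..t} h"
  shows "\<exists>x\<in>{s..t}. (LINT y:{s..t}|lebesgue. h y) \<le> (t - s) * h x"
proof (rule ccontr)
  assume none: "\<not> ?thesis"
  define m where "m = (LINT y:{s..t}|lebesgue. h y) / (t - s)"
  have below: "h x < m" if "x \<in> {s..t}" for x
    using none that \<open>s < t\<close> by (auto simp: m_def field_simps not_le)
  interpret finite_measure "lebesgue_on {s..t}"
    by (rule finite_measure_lebesgue_on) simp
  have "(LINT y:{s..t}|lebesgue. h y) = (LINT y|lebesgue_on {s..t}. h y)"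
    by (simp add: set_lebesgue_integral_def integral_restrict_space)
  also have "\<dots> < (LINT y|lebesgue_on {s..t}. m)"
  proof (rule integral_less_AE_space)
    show "integrable (lebesgue_on {s..t}) h"
      using h by (simp add: set_integrable_def integrable_restrict_space)
    show "AE x in lebesgue_on {s..t}. h x < m"
      using below by (intro AE_I2) simp
    show "emeasure (lebesgue_on {s..t}) (space (lebesgue_on {s..t})) \<noteq> 0"
      using \<open>s < t\<close> by (simp add: emeasure_restrict_space)
  qed simp
  also have "\<dots> = (t - s) * m"
    using \<open>s < t\<close> by (simp add: measure_restrict_space)
  also have "\<dots> = (LINT y:{s..t}|lebesgue. h y)"
    using \<open>s < t\<close> by (simp add: m_def)
  finally show False by simp
qed

lemma exists_le_mean:
  fixes h :: "real \<Rightarrow> real"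
  assumes "s < t" and "set_integrable lebesgue {s..t} h"
  shows "\<exists>x\<in>{s..t}. (t - s) * h x \<le> (LINT y:{s..t}|lebesgue. h y)"
  using exists_ge_mean[of s t "\<lambda>x. - h x"] assms
  by (simp add: set_integrable_def set_lebesgue_integral_def)

lemma set_integrable_one_over:
  fixes p :: "real \<Rightarrow> real"
  assumes "set_integrable lebesgue {s..t} p" and "\<And>x. x \<in> {s..t} \<Longrightarrow> 1 \<le> p x"
  shows "set_integrable lebesgue {s..t} (\<lambda>x. 1 / p x)"
  unfolding set_integrable_def
proof (rule Bochner_Integration.integrable_bound)
  show "integrable lebesgue (indicat_real {s..t})"
    by (intro integrable_real_indicator) (auto simp: emeasure_lborel_Icc_eq)
  have "(\<lambda>x. indicat_real {s..t} x *\<^sub>R p x) \<in> borel_measurable lebesgue"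
    using assms(1) by (simp add: set_integrable_def)
  then have "(\<lambda>x. 1 / (indicat_real {s..t} x *\<^sub>R p x)) \<in> borel_measurable lebesgue"
    by measurable
  \<comment> \<open>Off the interval both sides vanish, because \<open>1 / 0 = 0\<close>.\<close>
  also have "(\<lambda>x. 1 / (indicat_real {s..t} x *\<^sub>R p x)) = (\<lambda>x. indicat_real {s..t} x *\<^sub>R (1 / p x))"
    by (auto simp: indicator_def)
  finally show "(\<lambda>x. indicat_real {s..t} x *\<^sub>R (1 / p x)) \<in> borel_measurable lebesgue" .
  show "AE x in lebesgue. norm (indicat_real {s..t} x *\<^sub>R (1 / p x)) \<le> norm (indicat_real {s..t} x)"
    using assms(2) by (intro AE_I2) (fastforce simp: indicator_def)
qed

text \<open>
  At a point where \<open>1 / p\<close> is at least its mean, \<open>p\<close> is at most the inverse of that mean. Taking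
  inverses requires the mean to be positive, which the opposite mean value inequality provides.
\<close>
lemma exists_le_pbar:
  fixes p :: "real \<Rightarrow> real"
  assumes "s < t" and "set_integrable lebesgue {s..t} p" and ge1: "\<And>x. x \<in> {s..t} \<Longrightarrow> 1 \<le> p x"
  shows "\<exists>x\<in>{s..t}. p x \<le> pbar p s t"
proof -
  define I where "I = (LINT x:{s..t}|lebesgue. 1 / p x)"
  have int: "set_integrable lebesgue {s..t} (\<lambda>x. 1 / p x)"
    using assms(2) ge1 by (rule set_integrable_one_over)
  obtain y where y: "y \<in> {s..t}" "(t - s) * (1 / p y) \<le> I"
    using exists_le_mean[OF \<open>s < t\<close> int] unfolding I_def by blast
  have "0 < (t - s) * (1 / p y)"
    using ge1[OF y(1)] \<open>s < t\<close> by simp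
  with y have "0 < I" by linarith
  obtain x where x: "x \<in> {s..t}" "I \<le> (t - s) * (1 / p x)"
    using exists_ge_mean[OF \<open>s < t\<close> int] unfolding I_def by blast
  have "p x \<le> (t - s) / I"
    using x ge1[OF x(1)] \<open>0 < I\<close> by (simp add: field_simps)
  also have "\<dots> = pbar p s t"
    by (simp add: pbar_def I_def)
  finally show ?thesis using x(1) by blast
qed

lemma partitions_subinterval:
  assumes "(n, t) \<in> partitions a b" and "k < n"
  shows "{t k..t (Suc k)} \<subseteq> {a..b}"
proof -
  have ends: "t 0 = a" "t n = b" and step: "\<And>i. i < n \<Longrightarrow> t i \<le> t (Suc i)"
    using assms(1) by (auto simp: partitions_def less_imp_le)
  have "t (min i n) \<le> t (min (Suc i) n)" for i
    using step[of i] by (cases "i < n") (auto simp: min_def not_less)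
  then have mono: "t (min i n) \<le> t (min j n)" if "i \<le> j" for i j
    using that by (rule lift_Suc_mono_le[of "\<lambda>i. t (min i n)"])
  show ?thesis
    using mono[of 0 k] mono[of "Suc k" n] ends assms(2) by (auto simp: min_def)
qed

lemma WBV_var_le_1_if_BV_var_le_1:
  fixes p g :: "real \<Rightarrow> real"
  assumes p_ge1: "\<And>x. x \<in> {a..b} \<Longrightarrow> 1 \<le> p x"
    and p_int: "set_integrable lebesgue {a..b} p"
    and BV: "BV_var a b p g \<le> 1"
  shows "WBV_var a b p g \<le> 1"
  unfolding WBV_var_def
proof (rule SUP_least, clarify)
  fix n t assume part: "(n, t) \<in> partitions a b"
  have "\<exists>x\<in>{t k..t (Suc k)}. p x \<le> pbar p (t k) (t (Suc k))" if "k < n" for k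
  proof (rule exists_le_pbar)
    note sub = partitions_subinterval[OF part that]
    show "t k < t (Suc k)"
      using part that by (simp add: partitions_def)
    show "set_integrable lebesgue {t k..t (Suc k)} p"
      by (rule set_integrable_subset[OF p_int _ sub]) auto
    show "1 \<le> p x" if "x \<in> {t k..t (Suc k)}" for x
      using that sub p_ge1 by blast
  qed
  then obtain x where tag: "\<And>k. k < n \<Longrightarrow> x k \<in> {t k..t (Suc k)}"
    and le: "\<And>k. k < n \<Longrightarrow> p (x k) \<le> pbar p (t k) (t (Suc k))"
    by metis
  define d where "d k = \<bar>g (t (Suc k)) - g (t k)\<bar>" for k
  have "(n, t, x) \<in> tagged_partitions a b"
    using part tag by (simp add: tagged_partitions_def)
  then have "ennreal (\<Sum>k<n. d k powr p (x k)) \<le> BV_var a b p g"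
    unfolding BV_var_def d_def by (rule SUP_upper2) simp
  with BV have sum_le: "(\<Sum>k<n. d k powr p (x k)) \<le> 1"
    by (metis ennreal_le_1 order_trans)
  have "d k powr pbar p (t k) (t (Suc k)) \<le> d k powr p (x k)" if "k < n" for k
  proof -
    have "d k powr p (x k) \<le> (\<Sum>k<n. d k powr p (x k))"
      using that by (intro member_le_sum) auto
    with sum_le have "d k powr p (x k) \<le> 1" by linarith
    moreover have "0 < p (x k)"
      using p_ge1 tag[OF that] partitions_subinterval[OF part that] by fastforce
    ultimately have "d k \<le> 1"
      by (metis gr_one_powr not_le)
    then show ?thesis
      using le[OF that] by (intro powr_mono') (auto simp: d_def)
  qed
  then have "(\<Sum>k<n. d k powr pbar p (t k) (t (Suc k))) \<le> (\<Sum>k<n. d k powr p (x k))"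
    by (intro sum_mono) auto
  with sum_le show "ennreal (\<Sum>k<n. \<bar>g (t (Suc k)) - g (t k)\<bar> powr pbar p (t k) (t (Suc k))) \<le> 1"
    by (simp add: d_def)
qed

theorem theorem2p4:
  fixes a b :: real and p :: "real \<Rightarrow> real"
  assumes "a < b"
    and "\<And>x. x \<in> {a..b} \<Longrightarrow> 1 \<le> p x"
    and "set_integrable lebesgue {a..b} p"
    and "bounded (p ` {a..b})"
  shows "BV a b p \<subseteq> WBV a b p"
proof -
  have "WBV_norm a b p f \<le> BV_norm a b p f" for f
    unfolding WBV_norm_def BV_norm_def
    using WBV_var_le_1_if_BV_var_le_1[OF assms(2,3)] by (intro Inf_superset_mono) blast
  then show ?thesis
    unfolding BV_def WBV_def by (auto intro: le_less_trans)
qed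

end
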